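(* Let $f(x)=\tfrac12x'Qx+q'x$ be convex quadratic, let $0<\gamma<1/L_f$, and let $\lambda_k=\lambda=(1-\gamma L_f)/(1+\gamma L_f)$ for all $k$. Let $x^0\in\mathbb{R}^n$ and let the sequences be generated, for $k\ge0$, by $$y^k=\mathrm{prox}_{\gamma f}(x^k),\qquad z^k=\mathrm{prox}_{\gamma g}(2y^k-x^k),\qquad x^{k+1}=x^k+\lambda_k(z^k-y^k).$$ Then for every $\tilde x\in\tilde X$ and every $k\ge1$, $$F(z^{k+1})-F_\star\le\frac{1}{(2\gamma\lambda)k}\|x^0-\tilde x\|^2.$$
   Context: $Q\in\mathbb{R}^{n\times n}$ is symmetric positive semidefinite, $q\in\mathbb{R}^n$, $L_f=\lambda_{\max}(Q)$. Let $g:\mathbb{R}^n\to\mathbb{R}\cup\{+\infty\}$ be proper, closed and convex. Put $F=f+g$, assume that the set of minimizers of $F$ is nonempty, and let $F_\star=\min F$. For $\gamma>0$ and a proper closed convex function $h$, $\mathrm{prox}_{\gamma h}(x)=\arg\min_z\{h(z)+\tfrac{1}{2\gamma}\|z-x\|^2\}$. The set $\tilde X$ is the set of $x\in\mathbb{R}^n$ with $\mathrm{prox}_{\gamma g}(2\,\mathrm{prox}_{\gamma f}(x)-x)=\mathrm{prox}_{\gamma f}(x)$; the minimizers of $F$ are exactly the points $\mathrm{prox}_{\gamma f}(\tilde x)$, $\tilde x\in\tilde X$. Convention: $1/L_f=+\infty$ if $L_f=0$. *)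

theory Defs
  imports "HOL-Analysis.Analysis"
begin

definition psd_matrix :: "real ^ 'n ^ 'n \<Rightarrow> bool" where
  "psd_matrix Q \<longleftrightarrow> (\<forall>x. 0 \<le> x \<bullet> (Q *v x))"

definition eigenvalues :: "real ^ 'n ^ 'n \<Rightarrow> real set" where
  "eigenvalues Q = {\<mu>. \<exists>v. v \<noteq> 0 \<and> Q *v v = \<mu> *\<^sub>R v}"

(* Meant for symmetric Q, whose real spectrum is finite and nonempty. *)
definition lambda_max :: "real ^ 'n ^ 'n \<Rightarrow> real" where
  "lambda_max Q = Max (eigenvalues Q)"

definition quad_fun :: "real ^ 'n ^ 'n \<Rightarrow> real ^ 'n \<Rightarrow> real ^ 'n \<Rightarrow> real" where
  "quad_fun Q q x = 1 / 2 * (x \<bullet> (Q *v x)) + q \<bullet> x"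

(* The library's epigraph covers real-valued functions only.  Here the height ranges over
   the reals, so points where h is infinite contribute nothing. *)
definition ext_epigraph :: "('a \<Rightarrow> ereal) \<Rightarrow> ('a \<times> real) set" where
  "ext_epigraph h = {(x, r). h x \<le> ereal r}"

definition proper_fun :: "('a \<Rightarrow> ereal) \<Rightarrow> bool" where
  "proper_fun h \<longleftrightarrow> (\<forall>x. h x \<noteq> -\<infinity>) \<and> (\<exists>x. h x \<noteq> \<infinity>)"

definition closed_fun :: "('a::topological_space \<Rightarrow> ereal) \<Rightarrow> bool" where
  "closed_fun h \<longleftrightarrow> closed (ext_epigraph h)"

definition convex_fun :: "('a::real_vector \<Rightarrow> ereal) \<Rightarrow> bool" where
  "convex_fun h \<longleftrightarrow> convex (ext_epigraph h)"

definition minimizers :: "('a \<Rightarrow> ereal) \<Rightarrow> 'a set" where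
  "minimizers h = {x. is_arg_min h (\<lambda>_. True) x}"

(* For proper closed convex h and \<gamma> > 0 the minimizer exists and is unique, so that the
   choice made by ARG_MIN is immaterial. *)
definition prox :: "real \<Rightarrow> ('a::real_normed_vector \<Rightarrow> ereal) \<Rightarrow> 'a \<Rightarrow> 'a" where
  "prox \<gamma> h x = (ARG_MIN (\<lambda>z. h z + ereal (1 / (2 * \<gamma>) * (norm (z - x))\<^sup>2)) z. True)"

definition dr_fixed_set ::
    "real \<Rightarrow> ('a::real_normed_vector \<Rightarrow> ereal) \<Rightarrow> ('a \<Rightarrow> ereal) \<Rightarrow> 'a set" where
  "dr_fixed_set \<gamma> f g = {x. prox \<gamma> g (2 *\<^sub>R prox \<gamma> f x - x) = prox \<gamma> f x}"

end

theory Submission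
  imports Defs
begin

text \<open>
  The idea is to read the iteration as a preconditioned gradient method on a smooth convex
  function. Since \<open>f\<close> is quadratic, \<open>y = prox \<gamma> f x\<close> is the solution of
  \<open>y + \<gamma> (Q y + q) = x\<close>, so that \<open>2 y - x = y - \<gamma> \<nabla>f y\<close>: the point \<open>z\<close> is a proximal
  gradient step from \<open>y\<close>. Completing the square in \<open>f\<close> shows that \<open>z\<close> minimises
  \<open>F u + (1/2) \<parallel>u - y\<parallel>\<^sub>H\<^sup>2\<close> over \<open>u\<close>, where \<open>H = I / \<gamma> - Q\<close>. This \<open>H\<close> is positive definite because
  \<open>\<gamma> L < 1\<close>. The minimal value \<open>E y\<close>, the Moreau envelope of \<open>F\<close> in the metric \<open>H\<close>, is the
  Douglas-Rachford envelope written in the variable \<open>y\<close>. It lies above \<open>F z\<close> and is convex,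
  with gradient \<open>H (y - z)\<close>. Everything needed about it follows from the subgradient
  inequality \<open>F u \<ge> F z + \<langle>H (y - z), u - z\<rangle>\<close> (lemma \<open>prox_gradient_subgradient\<close>).

  In these variables the update is \<open>y' = y + \<lambda> v\<close>, where \<open>(I + \<gamma> Q) v = z - y\<close>. All matrices
  involved are polynomials in \<open>Q\<close> and commute, and the product of \<open>I + \<gamma> Q\<close> and \<open>H\<close> is
  \<open>I / \<gamma> - \<gamma> Q\<^sup>2\<close>. Let \<open>V\<close> be its quadratic form (the definition \<open>dr_potential\<close>). As
  \<open>0 < \<lambda> \<le> 1\<close>, a step lowers the envelope by at least \<open>(\<lambda>/2) V v\<close> (lemma \<open>dr_step_descent\<close>),
  and with \<open>s\<close> the minimiser belonging to the fixed point \<open>xt\<close>, convexity yields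
  \<open>E y' - F s \<le> (V (y - s) - V (y' - s)) / (2 \<lambda>)\<close> (lemma \<open>dr_gap_telescopes\<close>).
  Summing over the first \<open>k\<close> steps, and using that \<open>E\<close> decreases, bounds \<open>k (E (y k) - F s)\<close> by
  \<open>V (y 0 - s) / (2 \<lambda>)\<close>. Finally \<open>V u \<le> \<parallel>(I + \<gamma> Q) u\<parallel>\<^sup>2 / \<gamma>\<close>, and \<open>I + \<gamma> Q\<close> maps \<open>y 0 - s\<close> to
  \<open>x 0 - xt\<close>.

  Two things have to be supplied. The largest eigenvalue must bound the quadratic form of a
  symmetric matrix; this is the usual maximisation over the unit sphere. The minimum defining
  \<open>prox \<gamma> g\<close> must be attained: since \<open>F\<close> is bounded below, \<open>g\<close> is bounded below by a constant
  minus \<open>f\<close>, which the term \<open>\<parallel>u - w\<parallel>\<^sup>2 / (2 \<gamma>)\<close> dominates (lemma \<open>prox_attained\<close>).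
\<close>

section \<open>The largest eigenvalue of a symmetric matrix\<close>

text \<open>The quadratic \<open>t \<mapsto> \<langle>u + t v, A (u + t v)\<rangle>\<close> is nonnegative, so its discriminant
  is not positive. If \<open>\<langle>v, A v\<rangle> = 0\<close> it degenerates to an affine function, whose slope must vanish.\<close>
lemma psd_form_Cauchy_Schwarz:
  fixes A :: "'a::real_inner \<Rightarrow> 'a"
  assumes lin: "linear A" and sa: "\<And>u v. u \<bullet> A v = A u \<bullet> v"
    and psd: "\<And>u. 0 \<le> u \<bullet> A u"
  shows "(u \<bullet> A v)\<^sup>2 \<le> (u \<bullet> A u) * (v \<bullet> A v)"
proof -
  let ?a = "u \<bullet> A u" and ?b = "u \<bullet> A v" and ?c = "v \<bullet> A v"
  have quad: "0 \<le> ?a + 2 * t * ?b + t\<^sup>2 * ?c" for t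
  proof -
    have "v \<bullet> A u = ?b" using sa[of v u] by (simp add: inner_commute)
    then have "(u + t *\<^sub>R v) \<bullet> A (u + t *\<^sub>R v) = ?a + 2 * t * ?b + t\<^sup>2 * ?c"
      by (simp add: linear_add[OF lin] linear_scale[OF lin] inner_add_left inner_add_right
          algebra_simps power2_eq_square)
    with psd[of "u + t *\<^sub>R v"] show ?thesis by simp
  qed
  show ?thesis
  proof (cases "?c = 0")
    case True
    have "?b = 0"
    proof (rule ccontr)
      assume "?b \<noteq> 0"
      \<comment> \<open>at this point the affine function takes the value \<open>-1\<close>\<close>
      then show False using quad[of "- (?a + 1) / (2 * ?b)"] True by (simp add: field_simps)
    qed
    then show ?thesis using True by simp
  next
    case False
    then have "0 < ?c" using psd[of v] by simp
    then show ?thesis using quad[of "- ?b / ?c"]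
      by (simp add: field_simps power2_eq_square)
  qed
qed

text \<open>Let \<open>v\<close> maximise the form on the unit sphere, with value \<open>\<mu>\<close>. Then \<open>B = \<mu> I - A\<close> is
  positive semidefinite and its form vanishes at \<open>v\<close>, which by Cauchy-Schwarz for the form of
  \<open>B\<close> forces \<open>B v = 0\<close>.\<close>
lemma selfadjoint_max_eigenvector:
  fixes A :: "'a::euclidean_space \<Rightarrow> 'a"
  assumes lin: "linear A" and sa: "\<And>u v. u \<bullet> A v = A u \<bullet> v"
  obtains v \<mu> where "v \<noteq> 0" "A v = \<mu> *\<^sub>R v" "\<And>u. u \<bullet> A u \<le> \<mu> * (u \<bullet> u)"
proof -
  have "continuous_on (sphere 0 1) (\<lambda>u. u \<bullet> A u)"
    by (intro continuous_intros linear_continuous_on linear_conv_bounded_linear[THEN iffD1] lin)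
  moreover obtain b :: 'a where "b \<in> Basis" using nonempty_Basis by blast
  then have "sphere (0::'a) 1 \<noteq> {}" by (auto intro!: exI[of _ b])
  ultimately obtain v where v: "v \<in> sphere 0 1" and vmax: "\<And>u. u \<in> sphere 0 1 \<Longrightarrow> u \<bullet> A u \<le> v \<bullet> A v"
    using continuous_attains_sup[of "sphere (0::'a) 1"] by (metis compact_sphere)
  define \<mu> where "\<mu> = v \<bullet> A v"
  have vv: "v \<bullet> v = 1" using v by (simp add: norm_eq_1)
  have bound: "u \<bullet> A u \<le> \<mu> * (u \<bullet> u)" for u
  proof (cases "u = 0")
    case False
    have "(inverse (norm u) *\<^sub>R u) \<bullet> A (inverse (norm u) *\<^sub>R u) \<le> \<mu>"
      unfolding \<mu>_def using False by (intro vmax) simp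
    then show ?thesis using False
      by (simp add: linear_scale[OF lin] field_simps power2_norm_eq_inner[symmetric] power2_eq_square)
  qed simp
  define B where "B u = \<mu> *\<^sub>R u - A u" for u
  have linB: "linear B" unfolding B_def
    by (intro linear_compose_sub lin linear_compose_scale_right linear_ident)
  have "(B v \<bullet> B v)\<^sup>2 \<le> (B v \<bullet> B (B v)) * (v \<bullet> B v)"
    by (rule psd_form_Cauchy_Schwarz[OF linB])
      (use bound sa in \<open>auto simp: B_def inner_diff_left inner_diff_right\<close>)
  moreover have "v \<bullet> B v = 0" by (simp add: B_def inner_diff_right vv \<mu>_def)
  ultimately have "B v = 0" by simp
  then have "A v = \<mu> *\<^sub>R v" by (simp add: B_def)
  moreover have "v \<noteq> 0" using vv by auto
  ultimately show thesis using bound that by blast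
qed

lemma symmetric_matrix_inner:
  fixes Q :: "real ^ 'n ^ 'n"
  assumes "transpose Q = Q"
  shows "u \<bullet> (Q *v v) = (Q *v u) \<bullet> v"
  by (metis assms dot_lmul_matrix vector_transpose_matrix)

text \<open>Eigenvectors of distinct eigenvalues are orthogonal, hence linearly independent.
  Finiteness makes the maximum in the definition of \<open>lambda_max\<close> meaningful.\<close>
lemma finite_eigenvalues_symmetric:
  fixes Q :: "real ^ 'n ^ 'n"
  assumes sym: "transpose Q = Q"
  shows "finite (eigenvalues Q)"
proof -
  define e where "e \<mu> = (SOME v. v \<noteq> 0 \<and> Q *v v = \<mu> *\<^sub>R v)" for \<mu>
  have e: "e \<mu> \<noteq> 0 \<and> Q *v e \<mu> = \<mu> *\<^sub>R e \<mu>" if "\<mu> \<in> eigenvalues Q" for \<mu>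
    unfolding e_def by (rule someI_ex) (use that in \<open>simp add: eigenvalues_def\<close>)
  have orth: "e \<mu> \<bullet> e \<nu> = 0" if "\<mu> \<in> eigenvalues Q" "\<nu> \<in> eigenvalues Q" "\<mu> \<noteq> \<nu>" for \<mu> \<nu>
    using symmetric_matrix_inner[OF sym, of "e \<mu>" "e \<nu>"] e that by auto
  have inj: "inj_on e (eigenvalues Q)"
    by (rule inj_onI) (metis e orth inner_eq_zero_iff)
  have "pairwise orthogonal (e ` eigenvalues Q)"
    by (auto simp: pairwise_def orthogonal_def intro: orth)
  then have "independent (e ` eigenvalues Q)"
    by (rule pairwise_orthogonal_independent) (use e in force)
  then show ?thesis using inj finite_imageD independent_bound by blast
qed

lemma quadratic_form_le_lambda_max:
  fixes Q :: "real ^ 'n ^ 'n"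
  assumes sym: "transpose Q = Q"
  shows "u \<bullet> (Q *v u) \<le> lambda_max Q * (u \<bullet> u)"
proof -
  obtain v \<mu> where v: "v \<noteq> 0" "Q *v v = \<mu> *\<^sub>R v" and bound: "\<And>u. u \<bullet> (Q *v u) \<le> \<mu> * (u \<bullet> u)"
    using selfadjoint_max_eigenvector[of "(*v) Q"] symmetric_matrix_inner[OF sym]
      matrix_vector_mul_linear by metis
  have "\<mu> \<le> lambda_max Q" unfolding lambda_max_def
    by (rule Max_ge[OF finite_eigenvalues_symmetric[OF sym]]) (use v in \<open>auto simp: eigenvalues_def\<close>)
  then have "\<mu> * (u \<bullet> u) \<le> lambda_max Q * (u \<bullet> u)" by (intro mult_right_mono) auto
  with bound[of u] show ?thesis by linarith
qed

section \<open>Existence and optimality of proximal points\<close>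

lemma prox_is_arg_min:
  assumes "is_arg_min (\<lambda>z. h z + ereal (1 / (2 * \<gamma>) * (norm (z - x))\<^sup>2)) (\<lambda>_. True) p"
  shows "is_arg_min (\<lambda>z. h z + ereal (1 / (2 * \<gamma>) * (norm (z - x))\<^sup>2)) (\<lambda>_. True) (prox \<gamma> h x)"
  unfolding prox_def arg_min_def using assms by (rule someI)

text \<open>A lower semicontinuous function attains its minimum on a compact sublevel set. As the
  values of \<open>h\<close> may be infinite and closedness is a property of the epigraph, the argument is
  run on the epigraph: the part where the continuous function \<open>(u, r) \<mapsto> r + s u\<close> stays below one
  of its values is compact, and on it this function attains its minimum. Coercivity of \<open>m + s\<close>
  bounds the points \<open>u\<close> in this part, and the real-valued minorant \<open>m\<close> bounds the heights \<open>r\<close>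
  from below.\<close>
lemma closed_coercive_attains_min:
  fixes h :: "'a::euclidean_space \<Rightarrow> ereal" and s m :: "'a \<Rightarrow> real"
  assumes cl: "closed_fun h" and pr: "proper_fun h"
    and minorant: "\<And>u. ereal (m u) \<le> h u"
    and cont: "continuous_on UNIV m" "continuous_on UNIV s"
    and coercive: "\<And>c. bounded {u. m u + s u \<le> c}"
  shows "\<exists>p. is_arg_min (\<lambda>u. h u + ereal (s u)) (\<lambda>_. True) p"
proof -
  obtain u0 r0 where u0: "h u0 = ereal r0"
    using pr by (metis proper_fun_def real_of_ereal.elims)
  define c where "c = r0 + s u0"
  define S where "S = {u. m u + s u \<le> c}"
  define K where "K = ext_epigraph h \<inter> {(u, r). r + s u \<le> c}"
  have c1: "continuous_on UNIV (\<lambda>w. s (fst w))"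
    using continuous_on_compose2[OF cont(2) continuous_on_fst[OF continuous_on_id]] by auto
  have "closed {w. snd w + s (fst w) \<le> c}"
    by (intro closed_Collect_le continuous_intros c1)
  then have clK: "closed K" using cl unfolding K_def closed_fun_def
    by (auto simp: case_prod_unfold)
  have clS: "closed S" unfolding S_def by (intro closed_Collect_le continuous_intros cont)
  have cS: "compact S" using clS coercive[of c] unfolding S_def compact_eq_bounded_closed by simp
  have KS: "fst w \<in> S" "m (fst w) \<le> snd w" "snd w \<le> c - s (fst w)" if "w \<in> K" for w
  proof -
    have "ereal (m (fst w)) \<le> ereal (snd w)"
      using that order_trans[OF minorant[of "fst w"], of "ereal (snd w)"]
      by (auto simp: K_def ext_epigraph_def)
    then show a: "m (fst w) \<le> snd w" by simp
    show b: "snd w \<le> c - s (fst w)" using that by (auto simp: K_def)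
    show "fst w \<in> S" using a b by (simp add: S_def)
  qed
  have in_K: "(u0, r0) \<in> K" by (simp add: K_def ext_epigraph_def u0 c_def)
  then have "S \<noteq> {}" using KS(1) by force
  then obtain a b where a: "\<And>u. u \<in> S \<Longrightarrow> a \<le> m u" and b: "\<And>u. u \<in> S \<Longrightarrow> b \<le> s u"
    using continuous_attains_inf[OF cS] cont continuous_on_subset by (metis subset_UNIV)
  have "K \<subseteq> S \<times> {a..c - b}"
  proof
    fix w assume "w \<in> K"
    with KS[of w] a[of "fst w"] b[of "fst w"] show "w \<in> S \<times> {a..c - b}" by (auto simp: mem_Times_iff)
  qed
  then have "bounded K"
    using bounded_subset bounded_Times[OF compact_imp_bounded[OF cS] bounded_closed_interval] by blast
  then have "compact K" using clK compact_eq_bounded_closed by blast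
  moreover have "continuous_on K (\<lambda>w. snd w + s (fst w))"
    by (intro continuous_intros continuous_on_subset[OF c1]) auto
  ultimately obtain w where w: "w \<in> K" "\<forall>v\<in>K. snd w + s (fst w) \<le> snd v + s (fst v)"
    using continuous_attains_inf[of K "\<lambda>w. snd w + s (fst w)"] in_K by blast
  obtain p r where pr_eq: "w = (p, r)" by (cases w)
  have pK: "(p, r) \<in> K" using w(1) pr_eq by simp
  have pmin: "r + s p \<le> t + s u" if "(u, t) \<in> K" for u t
    using bspec[OF w(2) that] pr_eq by simp
  have "h p + ereal (s p) \<le> h u + ereal (s u)" for u
  proof -
    have "h p + ereal (s p) \<le> ereal (r + s p)"
      using pK by (cases "h p") (auto simp: K_def ext_epigraph_def)
    also have "\<dots> \<le> h u + ereal (s u)"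
    proof (cases "h u")
      case (real t)
      have "r + s p \<le> t + s u"
      proof (cases "t + s u \<le> c")
        case True
        then show ?thesis using real by (intro pmin) (simp add: K_def ext_epigraph_def)
      next
        case False
        then show ?thesis using pK by (simp add: K_def)
      qed
      then show ?thesis using real by simp
    next
      case MInf
      then show ?thesis using pr by (simp add: proper_fun_def)
    qed simp
    finally show ?thesis .
  qed
  then have "is_arg_min (\<lambda>u. h u + ereal (s u)) (\<lambda>_. True) p"
    by (simp add: is_arg_min_def not_less)
  then show ?thesis by blast
qed

text \<open>The minimality of \<open>p\<close> is tested along the segment from \<open>p\<close> to \<open>u\<close>, where convexity bounds
  \<open>h\<close>; dividing by the step length \<open>\<theta>\<close> and sending \<open>\<theta>\<close> to zero shows that \<open>(w - p) / \<gamma>\<close> is a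
  subgradient of \<open>h\<close> at \<open>p\<close>.\<close>
lemma prox_point_subgradient:
  fixes h :: "'a::real_inner \<Rightarrow> ereal"
  assumes cv: "convex_fun h" and pr: "proper_fun h" and \<gamma>: "0 < \<gamma>"
    and min: "is_arg_min (\<lambda>z. h z + ereal (1 / (2 * \<gamma>) * (norm (z - w))\<^sup>2)) (\<lambda>_. True) p"
  shows "\<exists>r. h p = ereal r \<and> (\<forall>u t. h u = ereal t \<longrightarrow> r + (w - p) \<bullet> (u - p) / \<gamma> \<le> t)"
proof -
  have le: "h p + ereal (1 / (2 * \<gamma>) * (norm (p - w))\<^sup>2) \<le> h u + ereal (1 / (2 * \<gamma>) * (norm (u - w))\<^sup>2)" for u
    using min by (auto simp: is_arg_min_def not_less)
  obtain u0 where "h u0 \<noteq> \<infinity>" using pr by (auto simp: proper_fun_def)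
  then have "h p \<noteq> \<infinity>" using le[of u0] by (cases "h u0") auto
  then obtain r where r: "h p = ereal r" using pr by (cases "h p") (auto simp: proper_fun_def)
  have "r + (w - p) \<bullet> (u - p) / \<gamma> \<le> t" if t: "h u = ereal t" for u t
  proof -
    define c where "c = t - r - (w - p) \<bullet> (u - p) / \<gamma>"
    define N where "N = (norm (u - p))\<^sup>2 / (2 * \<gamma>)"
    have small: "0 \<le> c + \<theta> * N" if \<theta>: "0 < \<theta>" "\<theta> \<le> 1" for \<theta>
    proof -
      let ?v = "(1 - \<theta>) *\<^sub>R p + \<theta> *\<^sub>R u"
      have "(1 - \<theta>) *\<^sub>R (p, r) + \<theta> *\<^sub>R (u, t) \<in> ext_epigraph h"
        using cv \<theta> r t unfolding convex_fun_def
        by (intro convexD) (auto simp: ext_epigraph_def)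
      then have hv: "h ?v \<le> ereal ((1 - \<theta>) * r + \<theta> * t)" by (simp add: ext_epigraph_def)
      have "ereal (r + 1 / (2 * \<gamma>) * (norm (p - w))\<^sup>2) \<le> h ?v + ereal (1 / (2 * \<gamma>) * (norm (?v - w))\<^sup>2)"
        using le[of ?v] r by simp
      also have "\<dots> \<le> ereal ((1 - \<theta>) * r + \<theta> * t) + ereal (1 / (2 * \<gamma>) * (norm (?v - w))\<^sup>2)"
        by (rule add_right_mono[OF hv])
      finally have le_v: "r + 1 / (2 * \<gamma>) * (norm (p - w))\<^sup>2
          \<le> (1 - \<theta>) * r + \<theta> * t + 1 / (2 * \<gamma>) * (norm (?v - w))\<^sup>2" by simp
      have sq: "(norm (?v - w))\<^sup>2
          = (norm (p - w))\<^sup>2 - 2 * \<theta> * ((w - p) \<bullet> (u - p)) + \<theta>\<^sup>2 * (norm (u - p))\<^sup>2"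
      proof -
        have "?v - w = (p - w) + \<theta> *\<^sub>R (u - p)" by (simp add: algebra_simps)
        then have "(norm (?v - w))\<^sup>2 = ((p - w) + \<theta> *\<^sub>R (u - p)) \<bullet> ((p - w) + \<theta> *\<^sub>R (u - p))"
          by (simp only: power2_norm_eq_inner)
        also have "\<dots> = (p - w) \<bullet> (p - w) + 2 * \<theta> * ((p - w) \<bullet> (u - p)) + \<theta>\<^sup>2 * ((u - p) \<bullet> (u - p))"
          by (simp only: inner_add_left inner_add_right inner_scaleR_left inner_scaleR_right
              inner_commute[of "u - p" "p - w"] power2_eq_square) (simp add: algebra_simps)
        also have "(p - w) \<bullet> (u - p) = - ((w - p) \<bullet> (u - p))"
          by (simp add: inner_diff_left)
        finally show ?thesis by (simp add: power2_norm_eq_inner)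
      qed
      have "1 / (2 * \<gamma>) * (norm (?v - w))\<^sup>2 = 1 / (2 * \<gamma>) * (norm (p - w))\<^sup>2
          - \<theta> * ((w - p) \<bullet> (u - p) / \<gamma>) + \<theta> * (\<theta> * N)"
        using \<gamma> by (simp only: N_def sq) (simp add: diff_divide_distrib add_divide_distrib power2_eq_square)
      with le_v have "0 \<le> \<theta> * t - \<theta> * r - \<theta> * ((w - p) \<bullet> (u - p) / \<gamma>) + \<theta> * (\<theta> * N)"
        by (simp add: left_diff_distrib del: times_divide_eq_right)
      also have "\<dots> = \<theta> * (c + \<theta> * N)"
        by (simp only: c_def distrib_left right_diff_distrib)
      finally have "0 \<le> \<theta> * (c + \<theta> * N)" .
      then show ?thesis using \<theta> by (simp add: zero_le_mult_iff)
    qed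
    have "((\<lambda>\<theta>. c + \<theta> * N) \<longlongrightarrow> c + 0 * N) (at_right 0)" by (intro tendsto_intros)
    moreover have "\<forall>\<^sub>F \<theta> in at_right 0. 0 \<le> c + \<theta> * N"
      using small by (auto simp: eventually_at_right_field intro!: exI[of _ 1])
    ultimately have "0 \<le> c + 0 * N" by (rule tendsto_lowerbound) simp
    then show ?thesis unfolding c_def by linarith
  qed
  with r show ?thesis by blast
qed

lemma quad_fun_expansion:
  fixes Q :: "real ^ 'n ^ 'n"
  assumes sym: "transpose Q = Q"
  shows "quad_fun Q q u = quad_fun Q q y + (Q *v y + q) \<bullet> (u - y) + (u - y) \<bullet> (Q *v (u - y)) / 2"
proof -
  have "u \<bullet> (Q *v y) = (Q *v y) \<bullet> u" "y \<bullet> (Q *v u) = (Q *v y) \<bullet> u" "y \<bullet> (Q *v y) = (Q *v y) \<bullet> y"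
    using symmetric_matrix_inner[OF sym] by (auto simp: inner_commute)
  then show ?thesis unfolding quad_fun_def
    by (simp add: matrix_vector_mult_diff_distrib inner_diff_left inner_diff_right inner_add_left field_simps)
qed

text \<open>The linear equation \<open>p + \<gamma> (Q p + q) = x\<close> is solvable because \<open>I + \<gamma> Q\<close> is injective.
  Its solution is the unique minimiser: every other point exceeds the minimal value by at least
  \<open>\<parallel>u - p\<parallel>\<^sup>2 / (2 \<gamma>)\<close>.\<close>
lemma prox_quad_fun:
  fixes Q :: "real ^ 'n ^ 'n"
  assumes sym: "transpose Q = Q" and psd: "psd_matrix Q" and \<gamma>: "0 < \<gamma>"
  shows "prox \<gamma> (\<lambda>u. ereal (quad_fun Q q u)) x
    + \<gamma> *\<^sub>R (Q *v prox \<gamma> (\<lambda>u. ereal (quad_fun Q q u)) x + q) = x"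
proof -
  let ?T = "\<lambda>v. v + \<gamma> *\<^sub>R (Q *v v)"
  let ?\<phi> = "\<lambda>u. quad_fun Q q u + 1 / (2 * \<gamma>) * (norm (u - x))\<^sup>2"
  let ?P = "prox \<gamma> (\<lambda>u. ereal (quad_fun Q q u)) x"
  have linT: "linear ?T"
    by (intro linear_compose_add linear_ident linear_compose_scale_right matrix_vector_mul_linear)
  have "inj ?T"
  proof (rule linear_injective_0[OF linT, THEN iffD2], intro allI impI)
    fix v assume "?T v = 0"
    then have "v \<bullet> v + \<gamma> * (v \<bullet> (Q *v v)) = 0"
      by (metis inner_add_right inner_scaleR_right inner_zero_right)
    moreover have "0 \<le> \<gamma> * (v \<bullet> (Q *v v))" using psd \<gamma> by (simp add: psd_matrix_def)
    ultimately have "v \<bullet> v \<le> 0" by linarith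
    then show "v = 0" using inner_gt_zero_iff[of v] by linarith
  qed
  then have "surj ?T" using linT linear_injective_imp_surjective by blast
  then obtain p where "?T p = x - \<gamma> *\<^sub>R q" using surjD[of ?T "x - \<gamma> *\<^sub>R q"] by auto
  then have p: "p + \<gamma> *\<^sub>R (Q *v p + q) = x" by (simp add: algebra_simps)
  have gap: "?\<phi> p + (u - p) \<bullet> (u - p) / (2 * \<gamma>) \<le> ?\<phi> u" for u
  proof -
    define e where "e = Q *v p + q"
    have "u - x = (u - p) - \<gamma> *\<^sub>R e" "p - x = - \<gamma> *\<^sub>R e" using p by (auto simp: e_def algebra_simps)
    then have "(norm (u - x))\<^sup>2 = (u - p) \<bullet> (u - p) - 2 * \<gamma> * (e \<bullet> (u - p)) + (norm (p - x))\<^sup>2"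
      by (simp only: power2_norm_eq_inner inner_diff_left[of "u - p"] inner_diff_right[of _ "u - p"]
          inner_commute[of "u - p" "\<gamma> *\<^sub>R e"]) simp
    then have "1 / (2 * \<gamma>) * (norm (u - x))\<^sup>2
        = (u - p) \<bullet> (u - p) / (2 * \<gamma>) - e \<bullet> (u - p) + 1 / (2 * \<gamma>) * (norm (p - x))\<^sup>2"
      using \<gamma> by (simp add: diff_divide_distrib add_divide_distrib)
    then have "?\<phi> u = ?\<phi> p + (u - p) \<bullet> (u - p) / (2 * \<gamma>) + (u - p) \<bullet> (Q *v (u - p)) / 2"
      using quad_fun_expansion[OF sym, of q u p, folded e_def] by linarith
    then show ?thesis using psd by (simp add: psd_matrix_def)
  qed
  have gap0: "?\<phi> p \<le> ?\<phi> u" for u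
  proof -
    have "0 \<le> (u - p) \<bullet> (u - p) / (2 * \<gamma>)" using \<gamma> by simp
    with gap[of u] show ?thesis by linarith
  qed
  then have "is_arg_min (\<lambda>u. ereal (quad_fun Q q u) + ereal (1 / (2 * \<gamma>) * (norm (u - x))\<^sup>2)) (\<lambda>_. True) p"
    by (simp add: is_arg_min_def not_less)
  from prox_is_arg_min[OF this] have "?\<phi> ?P \<le> ?\<phi> p"
    by (simp add: is_arg_min_def not_less)
  with gap[of ?P] have "(?P - p) \<bullet> (?P - p) / (2 * \<gamma>) \<le> 0" by linarith
  then have "(?P - p) \<bullet> (?P - p) \<le> 0" using \<gamma> by (simp add: divide_le_0_iff)
  then have "?P - p = 0" using inner_gt_zero_iff[of "?P - p"] by linarith
  then have "?P = p" by simp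
  with p show ?thesis by simp
qed


text \<open>Coercivity comes from boundedness below of the sum: the bound
  \<open>a\<close> on \<open>quad_fun Q q + g\<close> provides the minorant \<open>a - quad_fun Q q\<close> of \<open>g\<close>, and the quadratic
  part of \<open>quad_fun Q q\<close> is at most \<open>c < 1\<close> times \<open>\<parallel>u\<parallel>\<^sup>2 / (2 \<gamma>)\<close>.\<close>
lemma prox_attained:
  fixes Q :: "real ^ 'n ^ 'n"
  assumes pr: "proper_fun g" and cl: "closed_fun g" and \<gamma>: "0 < \<gamma>"
    and bd: "\<And>u. \<gamma> * (u \<bullet> (Q *v u)) \<le> c * (u \<bullet> u)" and c: "c < 1"
    and below: "\<And>u. ereal a \<le> ereal (quad_fun Q q u) + g u"
  shows "is_arg_min (\<lambda>u. g u + ereal (1 / (2 * \<gamma>) * (norm (u - w))\<^sup>2)) (\<lambda>_. True) (prox \<gamma> g w)"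
proof -
  define m where "m u = a - quad_fun Q q u" for u
  define s where "s u = 1 / (2 * \<gamma>) * (norm (u - w))\<^sup>2" for u :: "real ^ 'n"
  have minorant: "ereal (m u) \<le> g u" for u
    using below[of u] by (cases "g u") (auto simp: m_def)
  have cont: "continuous_on UNIV m" "continuous_on UNIV s" unfolding m_def s_def quad_fun_def
    by (intro continuous_intros linear_continuous_on
        linear_conv_bounded_linear[THEN iffD1] matrix_vector_mul_linear)+
  have coercive: "bounded {u. m u + s u \<le> b}" for b
  proof -
    define \<alpha> where "\<alpha> = (1 - c) / (2 * \<gamma>)"
    define \<beta> where "\<beta> = norm (q + (1 / \<gamma>) *\<^sub>R w)"
    define C where "C = \<bar>b - a\<bar>"
    have \<alpha>: "0 < \<alpha>" using c \<gamma> by (simp add: \<alpha>_def)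
    have "norm u \<le> 1 + (\<beta> + C) / \<alpha>" if u: "m u + s u \<le> b" for u
    proof (cases "norm u \<le> 1")
      case True
      have "0 \<le> (\<beta> + C) / \<alpha>" using \<alpha> by (simp add: \<beta>_def C_def)
      then show ?thesis using True by linarith
    next
      case False
      \<comment> \<open>the objective grows at least like \<open>\<alpha> \<parallel>u\<parallel>\<^sup>2 - \<beta> \<parallel>u\<parallel>\<close>, up to a constant\<close>
      have "m u + s u = a + (u \<bullet> u - \<gamma> * (u \<bullet> (Q *v u))) / (2 * \<gamma>)
          - (q + (1 / \<gamma>) *\<^sub>R w) \<bullet> u + (w \<bullet> w) / (2 * \<gamma>)"
        using \<gamma> by (simp add: m_def s_def quad_fun_def power2_norm_eq_inner inner_diff_left
            inner_diff_right inner_add_left inner_commute[of u w] field_simps)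
      moreover have "\<alpha> * (norm u)\<^sup>2 \<le> (u \<bullet> u - \<gamma> * (u \<bullet> (Q *v u))) / (2 * \<gamma>)"
        using bd[of u] \<gamma> by (simp add: \<alpha>_def power2_norm_eq_inner field_simps)
      moreover have "(q + (1 / \<gamma>) *\<^sub>R w) \<bullet> u \<le> \<beta> * norm u"
        unfolding \<beta>_def by (rule norm_cauchy_schwarz)
      moreover have "0 \<le> (w \<bullet> w) / (2 * \<gamma>)" using \<gamma> by simp
      ultimately have "\<alpha> * (norm u)\<^sup>2 \<le> \<beta> * norm u + C" using u by (simp add: C_def)
      also have "\<dots> \<le> (\<beta> + C) * norm u"
        using mult_left_mono[of 1 "norm u" C] False by (simp add: C_def algebra_simps)
      finally have "norm u * (\<alpha> * norm u) \<le> norm u * (\<beta> + C)"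
        by (simp add: power2_eq_square algebra_simps)
      moreover have "0 < norm u" using False by linarith
      ultimately have "\<alpha> * norm u \<le> \<beta> + C" by (simp only: mult_le_cancel_left_pos)
      then have "norm u \<le> (\<beta> + C) / \<alpha>" using \<alpha> by (simp add: field_simps)
      then show ?thesis by simp
    qed
    then show ?thesis unfolding bounded_iff by blast
  qed
  obtain p where "is_arg_min (\<lambda>u. g u + ereal (s u)) (\<lambda>_. True) p"
    using closed_coercive_attains_min[OF cl pr minorant cont coercive] by blast
  then show ?thesis unfolding s_def by (rule prox_is_arg_min)
qed

section \<open>The envelope metric\<close>

text \<open>The bilinear form of \<open>H = I / \<gamma> - A\<close>, the metric in which \<open>F\<close> is regularised.\<close>
definition resolvent_inner :: "real \<Rightarrow> ('a::real_inner \<Rightarrow> 'a) \<Rightarrow> 'a \<Rightarrow> 'a \<Rightarrow> real" where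
  "resolvent_inner \<gamma> A u v = u \<bullet> v / \<gamma> - A u \<bullet> v"

lemma resolvent_inner_diff:
  assumes "linear A"
  shows "resolvent_inner \<gamma> A (u - v) w = resolvent_inner \<gamma> A u w - resolvent_inner \<gamma> A v w"
    and "resolvent_inner \<gamma> A w (u - v) = resolvent_inner \<gamma> A w u - resolvent_inner \<gamma> A w v"
  by (simp_all add: resolvent_inner_def linear_diff[OF assms] inner_diff_left inner_diff_right
      diff_divide_distrib)

lemma resolvent_inner_scale:
  assumes "linear A"
  shows "resolvent_inner \<gamma> A (c *\<^sub>R u) w = c * resolvent_inner \<gamma> A u w"
    and "resolvent_inner \<gamma> A w (c *\<^sub>R u) = c * resolvent_inner \<gamma> A w u"
  by (simp_all add: resolvent_inner_def linear_scale[OF assms] algebra_simps)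

lemma resolvent_inner_commute:
  assumes "\<And>u v. u \<bullet> A v = A u \<bullet> v"
  shows "resolvent_inner \<gamma> A u v = resolvent_inner \<gamma> A v u"
  unfolding resolvent_inner_def using assms[of v u] by (simp add: inner_commute)

text \<open>This is \<open>\<gamma> A\<^sup>2 \<le> A\<close>, read off from \<open>\<gamma> A \<le> I\<close> without a square root of \<open>A\<close>:
  Cauchy-Schwarz for the form of \<open>A\<close>, applied to \<open>A v\<close> and \<open>v\<close>.\<close>
lemma psd_cocoercive:
  assumes lin: "linear A" and sa: "\<And>u v. u \<bullet> A v = A u \<bullet> v"
    and psd: "\<And>u. 0 \<le> u \<bullet> A u" and bd: "\<And>u. \<gamma> * (u \<bullet> A u) \<le> u \<bullet> u" and \<gamma>: "0 < \<gamma>"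
  shows "\<gamma> * (A v \<bullet> A v) \<le> v \<bullet> A v"
proof (cases "A v = 0")
  case False
  then have pos: "0 < A v \<bullet> A v" by simp
  have "\<gamma> * (A v \<bullet> A v)\<^sup>2 \<le> \<gamma> * ((A v \<bullet> A (A v)) * (v \<bullet> A v))"
    using psd_form_Cauchy_Schwarz[OF lin sa psd, of "A v" v] \<gamma> by simp
  also have "\<dots> \<le> (A v \<bullet> A v) * (v \<bullet> A v)"
    using mult_right_mono[OF bd[of "A v"] psd[of v]] by (simp add: mult.assoc)
  finally have "(A v \<bullet> A v) * (\<gamma> * (A v \<bullet> A v)) \<le> (A v \<bullet> A v) * (v \<bullet> A v)"
    by (simp add: power2_eq_square algebra_simps)
  with pos show ?thesis by simp
qed simp

text \<open>The quadratic form of \<open>(I + \<gamma> A) H = I / \<gamma> - \<gamma> A\<^sup>2\<close>. It plays the role of the squared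
  distance to the solution in the analysis of gradient descent.\<close>
definition dr_potential :: "real \<Rightarrow> ('a::real_inner \<Rightarrow> 'a) \<Rightarrow> 'a \<Rightarrow> real" where
  "dr_potential \<gamma> A u = (u \<bullet> u) / \<gamma> - \<gamma> * (A u \<bullet> A u)"

lemma resolvent_inner_shift:
  assumes lin: "linear A" and sa: "\<And>u v. u \<bullet> A v = A u \<bullet> v" and \<gamma>: "0 < \<gamma>"
  shows "resolvent_inner \<gamma> A (u + \<gamma> *\<^sub>R A u) v = u \<bullet> v / \<gamma> - \<gamma> * (A u \<bullet> A v)"
proof -
  have "A (A u) \<bullet> v = A u \<bullet> A v" using sa by metis
  then show ?thesis using \<gamma>
    by (simp add: resolvent_inner_def linear_add[OF lin] linear_scale[OF lin] inner_add_left
        field_simps)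
qed

text \<open>The distance between two governing points \<open>x\<close> is the norm of \<open>(I + \<gamma> A) u\<close>, with \<open>u\<close> the
  difference of the corresponding points \<open>y\<close>.
  This inequality turns the potential into the distance appearing in the rate.\<close>
lemma dr_potential_le:
  assumes psd: "\<And>u. 0 \<le> u \<bullet> A u" and \<gamma>: "0 < \<gamma>"
  shows "dr_potential \<gamma> A u \<le> (norm (u + \<gamma> *\<^sub>R A u))\<^sup>2 / \<gamma>"
proof -
  have "(norm (u + \<gamma> *\<^sub>R A u))\<^sup>2 = u \<bullet> u + 2 * \<gamma> * (u \<bullet> A u) + \<gamma> * (\<gamma> * (A u \<bullet> A u))"
    by (simp add: power2_norm_eq_inner inner_add_left inner_add_right inner_commute[of "A u" u] algebra_simps)
  moreover have "0 \<le> \<gamma> * (u \<bullet> A u)" "0 \<le> \<gamma> * (\<gamma> * (A u \<bullet> A u))" using psd[of u] \<gamma> by auto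
  ultimately show ?thesis using \<gamma> by (simp add: dr_potential_def field_simps)
qed

lemma dr_potential_nonneg:
  assumes lin: "linear A" and sa: "\<And>u v. u \<bullet> A v = A u \<bullet> v"
    and psd: "\<And>u. 0 \<le> u \<bullet> A u" and bd: "\<And>u. \<gamma> * (u \<bullet> A u) \<le> u \<bullet> u" and \<gamma>: "0 < \<gamma>"
  shows "0 \<le> dr_potential \<gamma> A u"
proof -
  have "\<gamma> * (\<gamma> * (A u \<bullet> A u)) \<le> \<gamma> * (u \<bullet> A u)"
    using psd_cocoercive[OF lin sa psd bd \<gamma>, of u] \<gamma> by simp
  also have "\<dots> \<le> u \<bullet> u" by (rule bd)
  finally show ?thesis using \<gamma> by (simp add: dr_potential_def field_simps)
qed

section \<open>One Douglas-Rachford step\<close>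

text \<open>Testing the new envelope with the old point \<open>z\<close> bounds it by
  \<open>F z + (1/2) \<parallel>z - y'\<parallel>\<^sub>H\<^sup>2\<close>; this is where the subgradient inequality at \<open>z'\<close> enters. Expanding
  \<open>z - y' = (z - y) - \<lambda> v\<close> leaves the decrease \<open>\<lambda> V v\<close> and the error \<open>(\<lambda>\<^sup>2/2) \<parallel>v\<parallel>\<^sub>H\<^sup>2\<close>. Half
  of the decrease pays for the error, because \<open>V - H = A - \<gamma> A\<^sup>2\<close> is nonnegative and
  \<open>\<lambda> \<le> 1\<close>. The numbers \<open>Fz\<close> and \<open>Fz'\<close> stand for the values of \<open>F\<close> at \<open>z\<close> and \<open>z'\<close>.\<close>
lemma dr_step_descent:
  fixes A :: "'a::real_inner \<Rightarrow> 'a"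
  assumes lin: "linear A" and sa: "\<And>u v. u \<bullet> A v = A u \<bullet> v"
    and psd: "\<And>u. 0 \<le> u \<bullet> A u" and bd: "\<And>u. \<gamma> * (u \<bullet> A u) \<le> u \<bullet> u" and \<gamma>: "0 < \<gamma>"
    and lam: "0 < lam" "lam \<le> 1"
    and step: "z - y = v + \<gamma> *\<^sub>R A v" "y' = y + lam *\<^sub>R v"
    and subgrad: "Fz' + resolvent_inner \<gamma> A (y' - z') (z - z') \<le> Fz"
  shows "Fz' + resolvent_inner \<gamma> A (y' - z') (y' - z') / 2
    \<le> Fz + resolvent_inner \<gamma> A (y - z) (y - z) / 2 - lam / 2 * dr_potential \<gamma> A v"
proof -
  let ?H = "resolvent_inner \<gamma> A"
  note bil = resolvent_inner_diff[OF lin] resolvent_inner_scale[OF lin]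
  have com: "?H u w = ?H w u" for u w by (rule resolvent_inner_commute[OF sa])
  have nonneg: "0 \<le> ?H u u" for u
    using bd[of u] sa[of u u] \<gamma> by (simp add: resolvent_inner_def field_simps)
  have dv: "?H (z - y) v = dr_potential \<gamma> A v"
    unfolding step(1) resolvent_inner_shift[OF lin sa \<gamma>] dr_potential_def ..
  have "dr_potential \<gamma> A v - ?H v v = A v \<bullet> v - \<gamma> * (A v \<bullet> A v)"
    by (simp add: dr_potential_def resolvent_inner_def)
  then have Hv: "?H v v \<le> dr_potential \<gamma> A v"
    using psd_cocoercive[OF lin sa psd bd \<gamma>, of v] sa[of v v] by simp
  have "lam * ?H v v \<le> 1 * ?H v v" using nonneg lam by (intro mult_right_mono) auto
  then have lamH: "lam * (lam * ?H v v) \<le> lam * dr_potential \<gamma> A v"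
    using Hv lam by (intro mult_left_mono) auto
  have "?H (y' - z') (y' - z') / 2 - ?H (y' - z') (z - z') = ?H (y' - z) (y' - z) / 2 - ?H (z - z') (z - z') / 2"
    by (simp add: bil com[of z y'] com[of z' y'] com[of z' z] field_simps)
  also have "\<dots> \<le> ?H (y' - z) (y' - z) / 2" using nonneg by simp
  finally have "Fz' + ?H (y' - z') (y' - z') / 2 \<le> Fz + ?H (y' - z) (y' - z) / 2"
    using subgrad by linarith
  moreover have "?H (y' - z) (y' - z)
      = ?H (y - z) (y - z) - 2 * lam * dr_potential \<gamma> A v + lam * (lam * ?H v v)"
  proof -
    have square: "?H (lam *\<^sub>R v - d) (lam *\<^sub>R v - d) = ?H d d - 2 * lam * ?H d v + lam * (lam * ?H v v)" for d
      by (simp add: bil com[of v d] algebra_simps)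
    have "y' - z = lam *\<^sub>R v - (z - y)" using step(2) by simp
    moreover have "?H (y - z) (y - z) = ?H (z - y) (z - y)" by (simp add: bil)
    ultimately show ?thesis using square[of "z - y"] by (simp only: dv)
  qed
  ultimately show ?thesis using lamH by (simp add: field_simps)
qed

text \<open>By convexity of the envelope, its gap at \<open>y\<close> is at most \<open>\<langle>H (z - y), s - y\<rangle>\<close>, where \<open>z - y\<close>
  is \<open>(I + \<gamma> A) v\<close>; this is the cross term in the expansion of \<open>V (y - s + \<lambda> v)\<close>. The
  remaining square term of that expansion is the decrease granted by \<open>dr_step_descent\<close>, so the
  left-hand side bounds the gap after the step.\<close>
lemma dr_gap_telescopes:
  fixes A :: "'a::real_inner \<Rightarrow> 'a"
  assumes lin: "linear A" and sa: "\<And>u v. u \<bullet> A v = A u \<bullet> v"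
    and bd: "\<And>u. \<gamma> * (u \<bullet> A u) \<le> u \<bullet> u" and \<gamma>: "0 < \<gamma>" and lam: "0 < lam"
    and step: "z - y = v + \<gamma> *\<^sub>R A v" "y' = y + lam *\<^sub>R v"
    and subgrad: "Fz + resolvent_inner \<gamma> A (y - z) (s - z) \<le> Fs"
  shows "Fz + resolvent_inner \<gamma> A (y - z) (y - z) / 2 - lam / 2 * dr_potential \<gamma> A v - Fs
    \<le> (dr_potential \<gamma> A (y - s) - dr_potential \<gamma> A (y' - s)) / (2 * lam)"
proof -
  let ?H = "resolvent_inner \<gamma> A"
  note bil = resolvent_inner_diff[OF lin] resolvent_inner_scale[OF lin]
  have nonneg: "0 \<le> ?H (y - z) (y - z)"
    using bd[of "y - z"] sa[of "y - z" "y - z"] \<gamma> by (simp add: resolvent_inner_def field_simps)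
  have cross: "?H (z - y) (y - s) = v \<bullet> (y - s) / \<gamma> - \<gamma> * (A v \<bullet> A (y - s))"
    unfolding step(1) by (rule resolvent_inner_shift[OF lin sa \<gamma>])
  have square: "dr_potential \<gamma> A (w + lam *\<^sub>R v)
      = dr_potential \<gamma> A w + 2 * lam * (v \<bullet> w / \<gamma> - \<gamma> * (A v \<bullet> A w)) + lam * (lam * dr_potential \<gamma> A v)" for w
    unfolding dr_potential_def
    by (simp add: linear_add[OF lin] linear_scale[OF lin] inner_add_left inner_add_right
        inner_commute[of w v] inner_commute[of "A w" "A v"] algebra_simps add_divide_distrib)
  have "y' - s = (y - s) + lam *\<^sub>R v" using step(2) by simp
  then have "dr_potential \<gamma> A (y' - s)
      = dr_potential \<gamma> A (y - s) + 2 * lam * ?H (z - y) (y - s) + lam * (lam * dr_potential \<gamma> A v)"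
    using square[of "y - s"] by (simp only: cross)
  then have "(dr_potential \<gamma> A (y - s) - dr_potential \<gamma> A (y' - s)) / (2 * lam)
      = - ?H (z - y) (y - s) - lam / 2 * dr_potential \<gamma> A v"
    using lam by (simp add: field_simps power2_eq_square)
  moreover have "- ?H (z - y) (y - s) = ?H (y - z) (y - z) - ?H (y - z) (s - z)"
    by (simp add: bil)
  ultimately show ?thesis using subgrad nonneg by linarith
qed

text \<open>The subgradient inequality of \<open>g\<close> at the proximal gradient point \<open>z\<close> involves the gradient
  of the quadratic at \<open>y\<close>, the one of the quadratic itself its gradient at \<open>z\<close>. The gradients
  differ by \<open>Q (y - z)\<close>, and subtracting this from \<open>(y - z) / \<gamma>\<close> produces the metric \<open>H\<close>.\<close>
lemma prox_gradient_subgradient: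
  fixes Q :: "real ^ 'n ^ 'n"
  assumes sym: "transpose Q = Q" and psd: "psd_matrix Q" and \<gamma>: "0 < \<gamma>"
    and cv: "convex_fun g" and pr: "proper_fun g"
    and min: "is_arg_min (\<lambda>u. g u + ereal (1 / (2 * \<gamma>) * (norm (u - (y - \<gamma> *\<^sub>R (Q *v y + q))))\<^sup>2)) (\<lambda>_. True) z"
  shows "\<exists>r. g z = ereal r \<and> (\<forall>u t. g u = ereal t \<longrightarrow>
    quad_fun Q q z + r + resolvent_inner \<gamma> ((*v) Q) (y - z) (u - z) \<le> quad_fun Q q u + t)"
proof -
  obtain r where r: "g z = ereal r" and sub: "\<And>u t. g u = ereal t \<Longrightarrow>
      r + (y - \<gamma> *\<^sub>R (Q *v y + q) - z) \<bullet> (u - z) / \<gamma> \<le> t"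
    using prox_point_subgradient[OF cv pr \<gamma> min] by blast
  have "quad_fun Q q z + r + resolvent_inner \<gamma> ((*v) Q) (y - z) (u - z) \<le> quad_fun Q q u + t"
    if t: "g u = ereal t" for u t
  proof -
    have "(y - \<gamma> *\<^sub>R (Q *v y + q) - z) \<bullet> (u - z) / \<gamma>
        = (y - z) \<bullet> (u - z) / \<gamma> - (Q *v y + q) \<bullet> (u - z)"
    proof -
      have "y - \<gamma> *\<^sub>R (Q *v y + q) - z = (y - z) - \<gamma> *\<^sub>R (Q *v y + q)" by simp
      then show ?thesis using \<gamma>
        by (simp only: inner_diff_left[of "y - z"] inner_scaleR_left) (simp add: diff_divide_distrib)
    qed
    moreover have "(Q *v (y - z)) \<bullet> (u - z) = (Q *v y + q) \<bullet> (u - z) - (Q *v z + q) \<bullet> (u - z)"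
      by (simp add: matrix_vector_mult_diff_distrib inner_diff_left inner_add_left)
    moreover have "quad_fun Q q z + (Q *v z + q) \<bullet> (u - z) \<le> quad_fun Q q u"
      using quad_fun_expansion[OF sym, of q u z] psd by (simp add: psd_matrix_def)
    ultimately show ?thesis using sub[OF t] by (simp add: resolvent_inner_def)
  qed
  with r show ?thesis by blast
qed

section \<open>The convergence rate\<close>

(* In ereal, 1 / 0 = \<infinity>, which is the convention for 1 / L when L = 0.
   The infimum Fstar is the minimum of F because minimizers are assumed to exist. *)
theorem theorem3:
  fixes Q :: "real ^ 'n ^ 'n" and q :: "real ^ 'n"
    and f g F :: "real ^ 'n \<Rightarrow> ereal" and Fstar :: ereal
    and L \<gamma> lam :: real
    and x y z :: "nat \<Rightarrow> real ^ 'n" and xt :: "real ^ 'n" and k :: nat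
  assumes Q_sym: "transpose Q = Q"
    and Q_psd: "psd_matrix Q"
    and f_def: "f = (\<lambda>u. ereal (quad_fun Q q u))"
    and L_def: "L = lambda_max Q"
    and g_proper: "proper_fun g"
    and g_closed: "closed_fun g"
    and g_convex: "convex_fun g"
    and F_def: "F = (\<lambda>u. f u + g u)"
    and F_min: "minimizers F \<noteq> {}"
    and Fstar_def: "Fstar = (INF u. F u)"
    and gamma_pos: "0 < \<gamma>"
    and gamma_less: "ereal \<gamma> < 1 / ereal L"
    and lam_def: "lam = (1 - \<gamma> * L) / (1 + \<gamma> * L)"
    and y_step: "\<And>i. y i = prox \<gamma> f (x i)"
    and z_step: "\<And>i. z i = prox \<gamma> g (2 *\<^sub>R y i - x i)"
    and x_step: "\<And>i. x (Suc i) = x i + lam *\<^sub>R (z i - y i)"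
    and xt_mem: "xt \<in> dr_fixed_set \<gamma> f g"
    and k_ge: "1 \<le> k"
  shows "F (z (Suc k)) - Fstar \<le> ereal (1 / (2 * \<gamma> * lam * real k) * (norm (x 0 - xt))\<^sup>2)"
proof -
  let ?A = "(*v) Q" and ?f = "quad_fun Q q"
  let ?H = "resolvent_inner \<gamma> ?A" and ?V = "dr_potential \<gamma> ?A"
  note lin = matrix_vector_mul_linear[of Q]
  have sa: "u \<bullet> ?A v = ?A u \<bullet> v" for u v by (rule symmetric_matrix_inner[OF Q_sym])
  have psd: "0 \<le> u \<bullet> ?A u" for u using Q_psd by (simp add: psd_matrix_def)
  have le_L: "u \<bullet> ?A u \<le> L * (u \<bullet> u)" for u
    unfolding L_def by (rule quadratic_form_le_lambda_max[OF Q_sym])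
  obtain b :: "real ^ 'n" where "b \<in> Basis" using nonempty_Basis by blast
  then have "0 \<le> L" using order_trans[OF psd le_L, of b] by (simp add: inner_same_Basis)
  moreover have \<gamma>L: "\<gamma> * L < 1"
  proof (cases "L = 0")
    case False
    then have "\<gamma> < 1 / L" using gamma_less by (simp add: one_ereal_def)
    then show ?thesis using \<open>0 \<le> L\<close> False by (simp add: field_simps)
  qed simp
  moreover have "0 \<le> \<gamma> * L" using \<open>0 \<le> L\<close> gamma_pos by simp
  ultimately have "0 < lam" "1 - \<gamma> * L \<le> 1 * (1 + \<gamma> * L)" "0 < 1 + \<gamma> * L"
    unfolding lam_def by (auto intro: divide_pos_pos)
  then have lam: "0 < lam" "lam \<le> 1" unfolding lam_def by (simp_all only: pos_divide_le_eq)
  have bdL: "\<gamma> * (u \<bullet> ?A u) \<le> \<gamma> * L * (u \<bullet> u)" for u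
    using mult_left_mono[OF le_L[of u] less_imp_le[OF gamma_pos]] by (simp only: mult.assoc)
  have bd: "\<gamma> * (u \<bullet> ?A u) \<le> u \<bullet> u" for u
    using bdL[of u] mult_right_mono[OF less_imp_le[OF \<gamma>L] inner_ge_zero[of u]] by (simp only: mult_1)

  \<comment> \<open>a minimizer of \<open>F\<close> provides the lower bound that makes \<open>prox \<gamma> g\<close> well defined\<close>
  obtain um where um: "\<And>u. F um \<le> F u"
    using F_min by (auto simp: minimizers_def is_arg_min_def not_less)
  obtain u1 r1 where "g u1 = ereal r1"
    using g_proper by (metis proper_fun_def real_of_ereal.elims)
  then have "F um \<noteq> \<infinity>" using um[of u1] by (auto simp: F_def f_def)
  moreover have "F um \<noteq> -\<infinity>" using g_proper by (auto simp: F_def f_def proper_fun_def)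
  ultimately obtain a where "F um = ereal a" by (cases "F um") auto
  then have below: "ereal a \<le> ereal (?f u) + g u" for u using um[of u] by (simp add: F_def f_def)
  have subgrad: "\<exists>r. g w = ereal r \<and> (\<forall>u t. g u = ereal t \<longrightarrow> ?f w + r + ?H (v - w) (u - w) \<le> ?f u + t)"
    if "v + \<gamma> *\<^sub>R (?A v + q) = p" "w = prox \<gamma> g (2 *\<^sub>R v - p)" for v w p
  proof -
    have "2 *\<^sub>R v - p = v - \<gamma> *\<^sub>R (?A v + q)" using that(1) by (auto simp: scaleR_2)
    then show ?thesis using that(2)
      prox_attained[OF g_proper g_closed gamma_pos bdL \<gamma>L below, of "v - \<gamma> *\<^sub>R (?A v + q)"]
      by (intro prox_gradient_subgradient[OF Q_sym Q_psd gamma_pos g_convex g_proper]) simp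
  qed

  have yx: "y i + \<gamma> *\<^sub>R (?A (y i) + q) = x i" for i
    using prox_quad_fun[OF Q_sym Q_psd gamma_pos] by (simp add: y_step f_def)
  have "\<forall>i. \<exists>r. g (z i) = ereal r \<and> (\<forall>u t. g u = ereal t \<longrightarrow>
      ?f (z i) + r + ?H (y i - z i) (u - z i) \<le> ?f u + t)"
    using subgrad[OF yx z_step] by (rule allI)
  from choice[OF this] obtain r where r: "\<And>i. g (z i) = ereal (r i)"
    and sub: "\<And>i u t. g u = ereal t \<Longrightarrow> ?f (z i) + r i + ?H (y i - z i) (u - z i) \<le> ?f u + t"
    by blast
  \<comment> \<open>at the fixed point the proximal gradient step returns \<open>yt\<close> itself, so its subgradient
    inequality has slope zero and says that \<open>yt\<close> minimises \<open>F\<close>\<close>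
  define yt where "yt = prox \<gamma> f xt"
  have ytx: "yt + \<gamma> *\<^sub>R (?A yt + q) = xt"
    using prox_quad_fun[OF Q_sym Q_psd gamma_pos] by (simp add: yt_def f_def)
  moreover have "yt = prox \<gamma> g (2 *\<^sub>R yt - xt)"
    using xt_mem by (simp add: dr_fixed_set_def yt_def)
  ultimately obtain rt where rt: "g yt = ereal rt"
    and subt: "\<And>u t. g u = ereal t \<Longrightarrow> ?f yt + rt \<le> ?f u + t"
    using subgrad[of yt xt yt] by (auto simp: resolvent_inner_def)
  have "F yt \<le> F u" for u
    using subt[of u] rt g_proper by (cases "g u") (auto simp: F_def f_def proper_fun_def)
  then have Fstar: "Fstar = ereal (?f yt + rt)"
    unfolding Fstar_def using rt by (intro antisym INF_lower2[of yt] INF_greatest) (auto simp: F_def f_def)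

  define E where "E i = ?f (z i) + r i + ?H (y i - z i) (y i - z i) / 2" for i
  \<comment> \<open>the solution of \<open>(I + \<gamma> Q) v = z - y\<close>, obtained from the next iterate instead of an inverse\<close>
  define v where "v i = (1 / lam) *\<^sub>R (y (Suc i) - y i)" for i
  have y_upd: "y (Suc i) = y i + lam *\<^sub>R v i" for i using lam by (simp add: v_def)
  have v: "z i - y i = v i + \<gamma> *\<^sub>R ?A (v i)" for i
  proof -
    have "lam *\<^sub>R (z i - y i) = x (Suc i) - x i" using x_step[of i] by simp
    also have "\<dots> = lam *\<^sub>R (v i + \<gamma> *\<^sub>R ?A (v i))"
      unfolding yx[of i, symmetric] yx[of "Suc i", symmetric]
      by (simp add: y_upd linear_add[OF lin] linear_scale[OF lin] algebra_simps)
    finally have "lam *\<^sub>R (z i - y i) = lam *\<^sub>R (v i + \<gamma> *\<^sub>R ?A (v i))" .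
    then show ?thesis using lam by simp
  qed
  have descent: "E (Suc i) \<le> E i - lam / 2 * ?V (v i)" for i
    unfolding E_def by (rule dr_step_descent[OF lin sa psd bd gamma_pos lam v y_upd sub[OF r]])
  have gap: "E (Suc i) - (?f yt + rt) \<le> (?V (y i - yt) - ?V (y (Suc i) - yt)) / (2 * lam)" for i
    using descent[of i] dr_gap_telescopes[OF lin sa bd gamma_pos lam(1) v y_upd sub[OF rt], of i]
    by (simp add: E_def)
  have dec: "E (Suc i) \<le> E i" for i
    using descent[of i] dr_potential_nonneg[OF lin sa psd bd gamma_pos, of "v i"] lam(1)
      mult_nonneg_nonneg[of "lam / 2" "?V (v i)"] by linarith
  have sum: "real i * (E i - (?f yt + rt)) \<le> (?V (y 0 - yt) - ?V (y i - yt)) / (2 * lam)" for i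
  proof (induction i)
    case (Suc i)
    have "real i * (E (Suc i) - (?f yt + rt)) \<le> real i * (E i - (?f yt + rt))"
      using dec[of i] by (intro mult_left_mono) auto
    with Suc.IH gap[of i] show ?case by (simp add: algebra_simps diff_divide_distrib)
  qed simp
  have "?V (y 0 - yt) \<le> (norm (x 0 - xt))\<^sup>2 / \<gamma>"
  proof -
    have "x 0 - xt = (y 0 - yt) + \<gamma> *\<^sub>R ?A (y 0 - yt)"
      unfolding yx[of 0, symmetric] ytx[symmetric] by (simp add: linear_diff[OF lin] algebra_simps)
    then show ?thesis using dr_potential_le[of ?A, OF psd gamma_pos, of "y 0 - yt"] by (simp only:)
  qed
  then have "(?V (y 0 - yt) - ?V (y k - yt)) / (2 * lam) \<le> (norm (x 0 - xt))\<^sup>2 / \<gamma> / (2 * lam)"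
    using dr_potential_nonneg[OF lin sa psd bd gamma_pos, of "y k - yt"] lam
    by (intro divide_right_mono) auto
  with sum[of k] have "real k * (E k - (?f yt + rt)) \<le> (norm (x 0 - xt))\<^sup>2 / \<gamma> / (2 * lam)"
    by linarith
  then have Ek: "E k - (?f yt + rt) \<le> 1 / (2 * \<gamma> * lam * real k) * (norm (x 0 - xt))\<^sup>2"
    using k_ge lam gamma_pos by (simp add: field_simps)
  \<comment> \<open>the rate holds for the envelope at step \<open>k\<close>, which dominates \<open>F\<close> at the next point \<open>z\<close>\<close>
  have "0 \<le> ?H (y (Suc k) - z (Suc k)) (y (Suc k) - z (Suc k))"
    using bd[of "y (Suc k) - z (Suc k)"] sa[of "y (Suc k) - z (Suc k)" "y (Suc k) - z (Suc k)"] gamma_pos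
    by (simp add: resolvent_inner_def field_simps)
  then have "?f (z (Suc k)) + r (Suc k) \<le> E k" using dec[of k] by (simp add: E_def)
  with Ek show ?thesis by (simp add: F_def f_def r Fstar)
qed

end
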